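(* Let $k\in\mathbb{N}_0$ and $n\in\mathbb{N}$. Then \[ n\, r_k(n) = 2k \left( \sigma^{\ast}(n)- 4 \sigma^{\ast}(n/2) + \sum_{j=1}^{n-1} r_k (j) \left( \sigma^{\ast}(n-j)- 4 \sigma^{\ast}\!\left(\tfrac{n-j}{2}\right) \right) \right). \]
   Context: For $k\in\mathbb{N}_0$ and $n\in\mathbb{N}_0$, $r_k(n)=\#\{(x_1,\dots,x_k)\in\mathbb{Z}^k : n=x_1^2+\dots+x_k^2\}$. The function $\sigma^{\ast}$ is defined on $\mathbb{Q}$ by $\sigma^{\ast}(q)=0$ if $q\notin\mathbb{N}=\{1,2,3,\dots\}$, and for $q\in\mathbb{N}$, $\sigma^{\ast}(q)=\sum_{d\mid q,\ q/d\text{ odd}} d$. *)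

theory Defs
  imports Complex_Main
begin

text \<open>
  Elements of $Z^k$ are integer lists of length \<open>k\<close>. The set below is always finite, so \<open>card\<close>
  is a genuine count; for \<open>k = 0\<close> it is \<open>{[]}\<close> if \<open>n = 0\<close> and empty otherwise.
\<close>

definition r :: "nat \<Rightarrow> nat \<Rightarrow> nat" where
  "r k n = card {xs :: int list. length xs = k \<and> int n = (\<Sum>x\<leftarrow>xs. x\<^sup>2)}"

text \<open>
  For \<open>q\<close> a positive natural number, \<open>nat \<lfloor>q\<rfloor>\<close> is \<open>q\<close> itself as an element of type \<open>nat\<close>.
\<close>

definition sigma_star :: "rat \<Rightarrow> int" where
  "sigma_star q =
    (if q \<in> \<nat> \<and> q \<noteq> 0
     then (let m = nat \<lfloor>q\<rfloor> in \<Sum>d | d dvd m \<and> odd (m div d). int d)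
     else 0)"

end

theory Submission
  imports Defs "HOL-Computational_Algebra.Formal_Power_Series"
begin

text \<open>
  For \<open>\<theta> = \<Sum>x\<in>\<int>. X ^ x\<^sup>2\<close> the coefficients of \<open>\<theta> ^ k\<close> are \<open>r k n\<close>, so applying \<open>X d/dX\<close> to
  \<open>\<theta> ^ k\<close> reduces the claim to the formula for \<open>X \<theta>' / \<theta>\<close>, whose coefficient at \<open>m\<close> is
  \<open>2 (\<sigma>\<^sup>*(m) - 4 \<sigma>\<^sup>*(m/2)) = 2 (-1)^(m-1) \<sigma>\<^sup>*(m)\<close>. That formula says that the sum of \<open>(-1)^i d\<close>
  over the solutions of \<open>i\<^sup>2 + d e = n\<close> with \<open>e\<close> odd and \<open>d, e > 0\<close> is \<open>(-1)^(n-1) n\<close> if \<open>n\<close> is a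
  square and \<open>0\<close> otherwise. By the symmetry \<open>i \<mapsto> -i\<close> the weight \<open>(-1)^i d\<close> may be replaced by
  \<open>(-1)^i (d + i)\<close>, and then sign-reversing involutions in the style of Liouville and Uspensky
  cancel all solutions except those with \<open>d + 2 i = e\<close>, for which \<open>n = (d + i)\<^sup>2\<close>.
\<close>

section \<open>Signed sums over the solutions of \<open>i^2 + d * e = n\<close> with
  \<open>e\<close> odd\<close>

lemma sum_sign_reversing_involution:
  fixes f :: "'a \<Rightarrow> int"
  assumes "\<And>x. x \<in> A \<Longrightarrow> h x \<in> A" "\<And>x. x \<in> A \<Longrightarrow> h (h x) = x"
    and "\<And>x. x \<in> A \<Longrightarrow> f (h x) = - f x"
  shows "sum f A = 0"
proof -
  have "sum f A = (\<Sum>x\<in>A. - f x)"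
    by (rule sum.reindex_bij_witness[of A h h]) (use assms in auto)
  then show ?thesis
    by (simp add: sum_negf)
qed

definition parity_sign :: "int \<Rightarrow> int" where
  "parity_sign i = (if even i then 1 else -1)"

lemma parity_sign_minus [simp]: "parity_sign (- i) = parity_sign i"
  by (simp add: parity_sign_def)

definition square_plus_odd :: "int \<Rightarrow> (int \<times> int \<times> int) set" where
  "square_plus_odd n = {(i, d, e). i\<^sup>2 + d * e = n \<and> odd e \<and> d > 0 \<and> e > 0}"

lemma finite_square_plus_odd: "finite (square_plus_odd n)"
proof (rule finite_subset)
  show "square_plus_odd n \<subseteq> {-n..n} \<times> {0..n} \<times> {0..n}"
  proof
    fix t assume "t \<in> square_plus_odd n"
    then obtain i d e where t: "t = (i, d, e)" "i\<^sup>2 + d * e = n" "d > 0" "e > 0"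
      by (auto simp: square_plus_odd_def)
    have "d * 1 \<le> d * e" "1 * e \<le> d * e"
      using t by (intro mult_mono; simp)+
    moreover have "\<bar>i\<bar> \<le> i\<^sup>2"
      using self_le_power[of "\<bar>i\<bar>" 2] by (cases "i = 0") auto
    moreover have "0 \<le> i\<^sup>2" by simp
    ultimately have "- n \<le> i" "i \<le> n" "d \<le> n" "e \<le> n"
      using t by linarith+
    then show "t \<in> {-n..n} \<times> {0..n} \<times> {0..n}"
      using t(1,3,4) by simp
  qed
qed simp

text \<open>The involution swaps the conditions \<open>d > 0\<close> and
  \<open>d + 2 * i > e\<close>, keeps \<open>d + i\<close> and \<open>e\<close>, and changes the
  parity of \<open>i\<close> because \<open>e\<close> is odd.\<close>

lemma sum_square_plus_odd_pos:
  "(\<Sum>(i, d, e) \<in> {(i, d, e) \<in> square_plus_odd n. d + 2 * i > e}. parity_sign i * (d + i)) = 0"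
  by (rule sum_sign_reversing_involution[where h = "\<lambda>(i, d, e). (e - i, d + 2 * i - e, e)"])
     (auto simp: square_plus_odd_def parity_sign_def algebra_simps power2_eq_square)

text \<open>
  In the coordinates \<open>x = e - 2 * i\<close>, \<open>y = d + i\<close>, \<open>z = 2 * d + 2 * i - e\<close> the equation reads
  \<open>4 * n = 4 * y\<^sup>2 + x\<^sup>2 - z\<^sup>2\<close>; the region below is \<open>x > \<bar>z\<bar>\<close>, \<open>2 * y > z\<close>, and the involution
  is \<open>z \<mapsto> - z\<close> if this preserves \<open>2 * y > z\<close>, and \<open>y \<mapsto> - y\<close> otherwise. The previous lemma uses
  \<open>x \<mapsto> - x\<close>.
\<close>

lemma sum_square_plus_odd_neg:
  "(\<Sum>(i, d, e) \<in> {(i, d, e) \<in> square_plus_odd n. d + 2 * i < e}. parity_sign i * (d + i)) = 0"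
proof (rule sum_sign_reversing_involution[where h = "\<lambda>(i, d, e).
    if 4 * (d + i) > e then (2 * d + 3 * i - e, e - d - 2 * i, 4 * (d + i) - e)
    else (- 2 * d - i, d, e - 4 * (d + i))"], goal_cases)
  case (1 t)
  obtain i d e where t: "t = (i, d, e)" by (cases t)
  have "odd e" using 1 t by (simp add: square_plus_odd_def)
  \<comment> \<open>Equality would give the second branch the third component 0, outside the
    solution set.\<close>
  then have "e \<noteq> 4 * (d + i)" by auto
  with 1 t show ?case
    by (auto simp: square_plus_odd_def algebra_simps power2_eq_square)
next
  case (2 t)
  then show ?case by (auto simp: square_plus_odd_def)
next
  case (3 t)
  \<comment> \<open>The first branch keeps \<open>d + i\<close> and flips the parity of
    \<open>i\<close>; the second negates \<open>d + i\<close> and keeps the parity.\<close>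
  then show ?case by (auto simp: square_plus_odd_def parity_sign_def algebra_simps)
qed

lemma sum_square_plus_odd_zero:
  assumes "n > 0"
  shows "(\<Sum>(i, d, e) \<in> {(i, d, e) \<in> square_plus_odd n. d + 2 * i = e}. parity_sign i * (d + i)) =
    (if \<exists>y. y\<^sup>2 = n then - parity_sign n * n else 0)"
proof (cases "\<exists>y. y\<^sup>2 = n")
  case True
  then obtain y where y: "\<bar>y\<bar>\<^sup>2 = n" by auto
  define m where "m = nat \<bar>y\<bar>"
  have m: "(int m)\<^sup>2 = n" using y by (simp add: m_def)
  \<comment> \<open>Obtained by solving \<open>d + i = m\<close>, \<open>d + 2 * i = e\<close> for
    \<open>e = 2 * l + 1\<close>; then \<open>d > 0\<close> means \<open>l < m\<close>. All
    \<open>m\<close> triples have the same weight, since \<open>i\<close> has the parity opposite to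
    \<open>m\<close>.\<close>
  let ?g = "\<lambda>l. (2 * int l + 1 - int m, 2 * int m - 2 * int l - 1, 2 * int l + 1)"
  have "{(i, d, e) \<in> square_plus_odd n. d + 2 * i = e} = ?g ` {..<m}" (is "?Z = _")
  proof (intro equalityI subsetI)
    fix t assume "t \<in> ?Z"
    then obtain i d e where t: "t = (i, d, e)"
      and h: "i\<^sup>2 + d * e = n" "odd e" "d > 0" "e > 0" "d + 2 * i = e"
      by (auto simp: square_plus_odd_def)
    have "(d + i)\<^sup>2 = (int m)\<^sup>2"
      using h m by (auto simp: power2_eq_square algebra_simps)
    moreover have "d + i > 0" using h by linarith
    ultimately have "d + i = int m" by (simp add: power2_eq_iff)
    moreover obtain l where "e = 2 * l + 1" using \<open>odd e\<close> by (elim oddE)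
    ultimately have "t = ?g (nat l)" "nat l \<in> {..<m}"
      using t h by auto
    then show "t \<in> ?g ` {..<m}" by blast
  next
    fix t assume "t \<in> ?g ` {..<m}"
    then show "t \<in> ?Z"
      by (auto simp: square_plus_odd_def m[symmetric] power2_eq_square algebra_simps)
  qed
  moreover have "inj_on ?g {..<m}" by (auto simp: inj_on_def)
  ultimately have "(\<Sum>(i, d, e) \<in> ?Z. parity_sign i * (d + i))
      = (\<Sum>l<m. - parity_sign (int m) * int m)"
    by (auto simp: sum.reindex parity_sign_def)
  also have "\<dots> = - parity_sign n * n"
    using m by (auto simp: parity_sign_def power2_eq_square)
  finally show ?thesis using True by simp
next
  case False
  have "{(i, d, e) \<in> square_plus_odd n. d + 2 * i = e} = {}"
  proof -
    have "(d + i)\<^sup>2 = n" if "i\<^sup>2 + d * (d + 2 * i) = n" for i d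
      using that by (simp add: power2_eq_square algebra_simps)
    with False show ?thesis by (auto simp: square_plus_odd_def)
  qed
  with False show ?thesis by (simp only: sum.empty if_False)
qed

lemma sum_square_plus_odd:
  assumes "n > 0"
  shows "(\<Sum>(i, d, e) \<in> square_plus_odd n. parity_sign i * d) =
    (if \<exists>y. y\<^sup>2 = n then - parity_sign n * n else 0)"
proof -
  let ?S = "square_plus_odd n"
  let ?P = "{(i, d, e) \<in> ?S. d + 2 * i > e}"
  let ?Z = "{(i, d, e) \<in> ?S. d + 2 * i = e}"
  let ?N = "{(i, d, e) \<in> ?S. d + 2 * i < e}"
  let ?f = "\<lambda>(i, d, e). parity_sign i * (d + i)"
  have fin: "finite ?P" "finite ?Z" "finite ?N"
    by (rule finite_subset[OF _ finite_square_plus_odd[of n]]; auto)+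
  have "(\<Sum>(i, d, e) \<in> ?S. parity_sign i * i) = 0"
    by (rule sum_sign_reversing_involution[where h = "\<lambda>(i, d, e). (- i, d, e)"])
       (auto simp: square_plus_odd_def)
  then have "(\<Sum>(i, d, e) \<in> ?S. parity_sign i * d) = sum ?f ?S"
    by (simp add: case_prod_unfold distrib_left sum.distrib)
  also have "\<dots> = sum ?f (?P \<union> ?Z \<union> ?N)"
    by (rule arg_cong[of _ _ "sum ?f"]) auto
  also have "\<dots> = sum ?f (?P \<union> ?Z) + sum ?f ?N"
    using fin by (intro sum.union_disjoint) auto
  also have "sum ?f (?P \<union> ?Z) = sum ?f ?P + sum ?f ?Z"
    using fin by (intro sum.union_disjoint) auto
  finally show ?thesis
    by (simp only: sum_square_plus_odd_pos sum_square_plus_odd_neg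
        sum_square_plus_odd_zero[OF assms] add_0_left add_0_right)
qed

section \<open>Divisor sums with odd codivisor\<close>

definition odd_codivisor_sum :: "nat \<Rightarrow> int" where
  "odd_codivisor_sum m = (\<Sum>d | d dvd m \<and> odd (m div d). int d)"

lemma sigma_star_of_nat: "m > 0 \<Longrightarrow> sigma_star (of_nat m) = odd_codivisor_sum m"
  by (simp add: sigma_star_def odd_codivisor_sum_def)

text \<open>An odd codivisor forces \<open>d\<close> to absorb the new factor 2, so each admissible
  divisor is doubled.\<close>

lemma odd_codivisor_sum_double: "odd_codivisor_sum (2 * h) = 2 * odd_codivisor_sum h"
proof -
  have "d \<in> (*) 2 ` {d. d dvd h \<and> odd (h div d)}" if d: "d dvd 2 * h" "odd (2 * h div d)" for d
  proof -
    have "even (2 * h div d * d)" using d(1) by simp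
    with d(2) have "even d" by (simp only: even_mult_iff simp_thms)
    with d show ?thesis by (auto elim!: evenE)
  qed
  then have "{d. d dvd 2 * h \<and> odd (2 * h div d)} = (*) 2 ` {d. d dvd h \<and> odd (h div d)}"
    by auto
  then show ?thesis
    by (simp add: odd_codivisor_sum_def sum.reindex sum_distrib_left inj_on_def)
qed

text \<open>Coefficients of half the logarithmic derivative \<open>X theta' / theta\<close>, with
  constant term 0.\<close>

definition theta_log_coeff :: "nat \<Rightarrow> int" where
  "theta_log_coeff m = (if m = 0 then 0 else - parity_sign (int m) * odd_codivisor_sum m)"

text \<open>For even \<open>m\<close> the doubling rule makes the second term twice the first; for
  odd \<open>m\<close> it vanishes, as \<open>m / 2\<close> is not natural.\<close>

lemma sigma_star_combination:
  assumes "m > 0"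
  shows "sigma_star (of_nat m) - 4 * sigma_star (of_nat m / 2) = theta_log_coeff m"
proof (cases "even m")
  case True
  then obtain h where h: "m = 2 * h" by blast
  then have half: "(of_nat m / 2 :: rat) = of_nat h" by simp
  have "h > 0" using h assms by simp
  then show ?thesis
    unfolding half using assms h
    by (simp add: sigma_star_of_nat odd_codivisor_sum_double theta_log_coeff_def parity_sign_def
        del: of_nat_mult)
next
  case False
  have "(of_nat m / 2 :: rat) \<notin> \<nat>"
  proof
    assume "(of_nat m / 2 :: rat) \<in> \<nat>"
    then obtain h where "(of_nat m / 2 :: rat) = of_nat h" by (elim Nats_cases)
    then have "(of_nat m :: rat) = of_nat (2 * h)" by simp
    then have "m = 2 * h" by (simp only: of_nat_eq_iff)
    with False show False by simp
  qed
  then have "sigma_star (of_nat m / 2) = 0" by (simp add: sigma_star_def)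
  with False assms show ?thesis
    by (simp add: sigma_star_of_nat theta_log_coeff_def parity_sign_def)
qed

section \<open>Integer square roots and the coefficient recurrence of theta\<close>

definition int_sqrts :: "nat \<Rightarrow> int set" where
  "int_sqrts n = {x. x\<^sup>2 = int n}"

lemma finite_int_sqrts: "finite (int_sqrts n)"
proof (rule finite_subset)
  show "int_sqrts n \<subseteq> {- int n..int n}"
  proof
    fix x assume "x \<in> int_sqrts n"
    then have "\<bar>x\<bar> \<le> int n"
      using self_le_power[of "\<bar>x\<bar>" 2] by (cases "x = 0") (auto simp: int_sqrts_def)
    then show "x \<in> {- int n..int n}" by auto
  qed
qed simp

lemma card_int_sqrts:
  assumes "n > 0"
  shows "card (int_sqrts n) = (if \<exists>y. y\<^sup>2 = int n then 2 else 0)"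
proof (cases "\<exists>y. y\<^sup>2 = int n")
  case True
  then obtain y where y: "y\<^sup>2 = int n" by blast
  then have "int_sqrts n = {y, - y}"
    by (auto simp: int_sqrts_def power2_eq_iff simp flip: y)
  moreover have "y \<noteq> 0" using y assms by auto
  ultimately show ?thesis using True by simp
qed (auto simp: int_sqrts_def)

text \<open>Expanding the root counts and divisor sums gives a sum over triples
  \<open>(i, d, e)\<close> with \<open>j = i^2\<close> and \<open>e = (n - j) / d\<close>, which the
  involutions have evaluated.\<close>

lemma theta_recurrence:
  assumes "n > 0"
  shows "int n * int (card (int_sqrts n)) =
    2 * (\<Sum>j\<le>n. int (card (int_sqrts j)) * theta_log_coeff (n - j))"
proof -
  have codivisor: "n - nat (i\<^sup>2) = nat d * nat e \<and> nat (i\<^sup>2) < n \<and> d > 0 \<and> e > 0 \<and> odd e"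
    if "(i, d, e) \<in> square_plus_odd (int n)" for i d e
  proof -
    have h: "i\<^sup>2 + d * e = int n" "d > 0" "e > 0" "odd e"
      using that by (auto simp: square_plus_odd_def)
    have "d * e > 0" using h by simp
    then have less: "i\<^sup>2 < int n" using h by linarith
    then have "int (n - nat (i\<^sup>2)) = int (nat d * nat e)"
      using h by (simp add: of_nat_diff nat_le_iff)
    then have "n - nat (i\<^sup>2) = nat d * nat e" by (simp only: of_nat_eq_iff)
    then show ?thesis using less h by (simp add: nat_less_iff)
  qed
  have "(\<Sum>j\<le>n. int (card (int_sqrts j)) * theta_log_coeff (n - j))
      = (\<Sum>j<n. int (card (int_sqrts j)) * theta_log_coeff (n - j))"
    \<comment> \<open>The term \<open>j = n\<close> is zero; dropping it leaves
      \<open>n - j > 0\<close>, which has finitely many divisors.\<close>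
    by (simp add: theta_log_coeff_def flip: lessThan_Suc_atMost)
  also have "\<dots> = (\<Sum>j<n. \<Sum>i\<in>int_sqrts j. \<Sum>d | d dvd n - j \<and> odd ((n - j) div d).
      - parity_sign (int n) * (parity_sign i * int d))"
  proof (intro sum.cong refl)
    fix j assume "j \<in> {..<n}"
    then have "j < n" by simp
    then have "parity_sign (int (n - j)) = parity_sign (int n) * parity_sign i"
      if "i \<in> int_sqrts j" for i
    proof -
      have "even (int j) \<longleftrightarrow> even i"
        using that even_power[of i 2] by (simp add: int_sqrts_def del: even_power)
      then show ?thesis using \<open>j < n\<close> by (auto simp: parity_sign_def)
    qed
    then have "(\<Sum>i\<in>int_sqrts j. \<Sum>d | d dvd n - j \<and> odd ((n - j) div d).
        - parity_sign (int n) * (parity_sign i * int d))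
      = (\<Sum>i\<in>int_sqrts j. theta_log_coeff (n - j))"
      using \<open>j < n\<close>
      by (intro sum.cong) (auto simp: theta_log_coeff_def odd_codivisor_sum_def sum_distrib_left mult.assoc
          simp flip: sum_negf)
    then show "int (card (int_sqrts j)) * theta_log_coeff (n - j) =
        (\<Sum>i\<in>int_sqrts j. \<Sum>d | d dvd n - j \<and> odd ((n - j) div d).
          - parity_sign (int n) * (parity_sign i * int d))" by simp
  qed
  also have "\<dots> = (\<Sum>(j, i, d) \<in> (SIGMA j:{..<n}. SIGMA i:int_sqrts j.
      {d. d dvd n - j \<and> odd ((n - j) div d)}). - parity_sign (int n) * (parity_sign i * int d))"
  proof (subst sum.Sigma[symmetric])
    have fin: "finite {d. d dvd n - j \<and> odd ((n - j) div d)}" if "j < n" for j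
      using that by simp
    then show "\<forall>j\<in>{..<n}. finite (SIGMA i:int_sqrts j. {d. d dvd n - j \<and> odd ((n - j) div d)})"
      by (auto simp: finite_int_sqrts)
    show "(\<Sum>j<n. \<Sum>i\<in>int_sqrts j. \<Sum>d | d dvd n - j \<and> odd ((n - j) div d).
        - parity_sign (int n) * (parity_sign i * int d)) =
      (\<Sum>j<n. \<Sum>(i, d) \<in> (SIGMA i:int_sqrts j. {d. d dvd n - j \<and> odd ((n - j) div d)}).
        - parity_sign (int n) * (parity_sign i * int d))"
      using fin by (intro sum.cong[OF refl] sum.Sigma) (auto simp: finite_int_sqrts)
  qed simp
  also have "\<dots> = (\<Sum>(i, d, e) \<in> square_plus_odd (int n).
      - parity_sign (int n) * (parity_sign i * d))"
  proof (rule sum.reindex_bij_witness[of _ "\<lambda>(i, d, e). (nat (i\<^sup>2), i, nat d)"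
        "\<lambda>(j, i, d). (i, int d, int ((n - j) div d))"], goal_cases)
    case (3 t)
    then show ?case by (cases t) (auto dest!: codivisor)
  next
    case (4 t)
    then show ?case by (cases t) (auto simp: int_sqrts_def even_nat_iff dest!: codivisor)
  next
    case (2 t)
    then obtain j i d where t: "t = (j, i, d)"
      and h: "j < n" "i\<^sup>2 = int j" "d dvd n - j" "odd ((n - j) div d)"
      by (auto simp: int_sqrts_def)
    have "d * ((n - j) div d) = n - j" using h by simp
    then have "int d * int ((n - j) div d) = int (n - j)" by (simp only: flip: of_nat_mult)
    moreover have "(n - j) div d > 0" "d > 0" using h by (auto intro: odd_pos Nat.gr0I)
    ultimately show ?case using t h by (simp add: square_plus_odd_def of_nat_diff)
  qed (auto simp: int_sqrts_def)
  also have "\<dots> = - parity_sign (int n) * (\<Sum>(i, d, e) \<in> square_plus_odd (int n). parity_sign i * d)"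
    by (simp add: sum_distrib_left case_prod_unfold)
  also have "\<dots> = (if \<exists>y. y\<^sup>2 = int n then int n else 0)"
    using assms by (simp add: sum_square_plus_odd) (simp add: parity_sign_def)
  \<comment> \<open>A positive square has exactly two integer roots, which matches the factor
    2.\<close>
  finally show ?thesis
    using assms by (simp add: card_int_sqrts)
qed

section \<open>Logarithmic derivatives of theta and its powers\<close>

definition theta :: "int fps" where
  "theta = Abs_fps (\<lambda>n. int (card (int_sqrts n)))"

lemma theta_deriv: "fps_X * fps_deriv theta = 2 * theta * Abs_fps theta_log_coeff"
proof (rule fps_ext)
  fix n
  show "fps_nth (fps_X * fps_deriv theta) n = fps_nth (2 * theta * Abs_fps theta_log_coeff) n"
  proof (cases "n = 0")
    case True
    then show ?thesis by (simp add: theta_log_coeff_def)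
  next
    case False
    have "fps_nth (2 * (theta * Abs_fps theta_log_coeff)) n =
        2 * fps_nth (theta * Abs_fps theta_log_coeff) n"
      by (simp only: numeral_fps_const fps_mult_left_const_nth)
    with False theta_recurrence[of n] show ?thesis
      by (simp only: mult.assoc fps_X_mult_nth if_False)
        (simp add: fps_mult_nth theta_def atLeast0AtMost)
  qed
qed

text \<open>Taking the \<open>k\<close>-th power multiplies the logarithmic derivative by
  \<open>k\<close>; avoiding quotients keeps the identity over the integers.\<close>

lemma theta_power_deriv:
  "fps_X * fps_deriv (theta ^ k) = of_nat (2 * k) * (theta ^ k * Abs_fps theta_log_coeff)"
proof (cases k)
  case (Suc l)
  have "fps_X * fps_deriv (theta ^ k) = of_nat k * theta ^ l * (fps_X * fps_deriv theta)"
    by (simp only: fps_deriv_power Suc diff_Suc_1 fps_of_nat ac_simps)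
  then show ?thesis
    by (simp add: theta_deriv Suc algebra_simps)
qed simp

section \<open>Representation counts as coefficients of powers of theta\<close>

definition square_reps :: "nat \<Rightarrow> nat \<Rightarrow> int list set" where
  "square_reps k n = {xs. length xs = k \<and> int n = (\<Sum>x\<leftarrow>xs. x\<^sup>2)}"

text \<open>Splitting off the first entry \<open>x\<close> and indexing by \<open>j = x^2\<close>
  prepares the count as a Cauchy product.\<close>

lemma square_reps_Suc:
  "square_reps (Suc k) n =
    (\<lambda>(j, x, ys). x # ys) ` (SIGMA j:{..n}. int_sqrts j \<times> square_reps k (n - j))"
proof (intro equalityI subsetI)
  fix xs assume "xs \<in> square_reps (Suc k) n"
  then obtain x ys where xs: "xs = x # ys" "length ys = k" "int n = x\<^sup>2 + (\<Sum>x\<leftarrow>ys. x\<^sup>2)"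
    by (auto simp: square_reps_def length_Suc_conv)
  have "(\<Sum>x\<leftarrow>ys. x\<^sup>2) \<ge> 0" by (intro sum_list_nonneg) auto
  then have "(nat (x\<^sup>2), x, ys) \<in> (SIGMA j:{..n}. int_sqrts j \<times> square_reps k (n - j))"
    using xs by (auto simp: int_sqrts_def square_reps_def of_nat_diff nat_le_iff)
  with xs show "xs \<in> (\<lambda>(j, x, ys). x # ys) `
      (SIGMA j:{..n}. int_sqrts j \<times> square_reps k (n - j))"
    by (intro image_eqI) auto
qed (auto simp: int_sqrts_def square_reps_def of_nat_diff)

lemma finite_square_reps: "finite (square_reps k n)"
proof (induction k arbitrary: n)
  case 0
  show ?case by (rule finite_subset[of _ "{[]}"]) (auto simp: square_reps_def)
qed (simp add: square_reps_Suc finite_int_sqrts)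

lemma r_Suc: "r (Suc k) n = (\<Sum>j\<le>n. card (int_sqrts j) * r k (n - j))"
proof -
  have "inj_on (\<lambda>(j, x, ys). x # ys) (SIGMA j:{..n}. int_sqrts j \<times> square_reps k (n - j))"
    by (auto simp: inj_on_def int_sqrts_def)
  then have "card (square_reps (Suc k) n) =
      (\<Sum>j\<le>n. card (int_sqrts j) * card (square_reps k (n - j)))"
    by (simp add: square_reps_Suc card_image card_SigmaI finite_int_sqrts finite_square_reps
        card_cartesian_product)
  then show ?thesis by (simp add: r_def square_reps_def)
qed

lemma theta_power_nth: "fps_nth (theta ^ k) n = int (r k n)"
proof (induction k arbitrary: n)
  case 0
  have "{xs :: int list. length xs = 0 \<and> int n = (\<Sum>x\<leftarrow>xs. x\<^sup>2)} = (if n = 0 then {[]} else {})"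
    by auto
  then show ?case by (simp add: r_def)
next
  case (Suc k)
  then show ?case by (simp add: r_Suc fps_mult_nth theta_def atLeast0AtMost)
qed

lemma r_0_right: "r k 0 = 1"
proof -
  have "int (r k 0) = fps_nth theta 0 ^ k"
    unfolding theta_power_nth[symmetric] by (rule fps_nth_power_0)
  then show ?thesis by (simp add: theta_def int_sqrts_def)
qed

theorem theorem2p2:
  fixes k n :: nat
  assumes "n \<ge> 1"
  shows "int n * int (r k n) =
    2 * int k *
      (sigma_star (of_nat n) - 4 * sigma_star (of_nat n / 2) +
       (\<Sum>j = 1..n - 1. int (r k j) *
          (sigma_star (of_nat n - of_nat j) - 4 * sigma_star ((of_nat n - of_nat j) / 2))))"
proof -
  have "int n * int (r k n) = fps_nth (fps_X * fps_deriv (theta ^ k)) n"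
    using assms by (simp add: theta_power_nth)
  also have "\<dots> = 2 * int k * (\<Sum>j\<le>n. int (r k j) * theta_log_coeff (n - j))"
    by (simp only: theta_power_deriv fps_of_nat[symmetric] fps_mult_left_const_nth)
       (simp add: fps_mult_nth theta_power_nth atLeast0AtMost)
  \<comment> \<open>The term \<open>j = 0\<close> becomes the isolated summand because
    \<open>r k 0 = 1\<close>; the term \<open>j = n\<close> vanishes with
    \<open>theta_log_coeff 0\<close>.\<close>
  also have "{..n} = insert 0 (insert n {1..n - 1})"
    using assms by auto
  also have "(\<Sum>j\<in>\<dots>. int (r k j) * theta_log_coeff (n - j)) =
      theta_log_coeff n + (\<Sum>j = 1..n - 1. int (r k j) * theta_log_coeff (n - j))"
    using assms by (simp add: r_0_right theta_log_coeff_def)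
  also have "(\<Sum>j = 1..n - 1. int (r k j) * theta_log_coeff (n - j)) =
      (\<Sum>j = 1..n - 1. int (r k j) *
        (sigma_star (of_nat n - of_nat j) - 4 * sigma_star ((of_nat n - of_nat j) / 2)))"
  proof (intro sum.cong refl)
    fix j assume "j \<in> {1..n - 1}"
    then have "n - j > 0" "(of_nat n - of_nat j :: rat) = of_nat (n - j)" by auto
    then show "int (r k j) * theta_log_coeff (n - j) = int (r k j) *
        (sigma_star (of_nat n - of_nat j) - 4 * sigma_star ((of_nat n - of_nat j) / 2))"
      by (simp only: sigma_star_combination)
  qed
  finally show ?thesis
    using assms by (simp add: sigma_star_combination)
qed

end
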